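(* $r(\mathfrak B_c,\ell_\infty^* )=2$, that is, $$\inf_{B_1\in\mathfrak B_c}\ \sup_{B_2\in\mathfrak B_c}\|B_1-B_2\|_{\ell_\infty^*}=2.$$
   Context: $\ell_\infty$ is the space of bounded real sequences with the sup norm and coordinatewise order, and $\ell_\infty^*$ is its dual with the dual norm. $T$ is the left shift, $T(x_1,x_2,x_3,\dots)=(x_2,x_3,x_4,\dots)$. A Banach limit is a functional $B\in\ell_\infty^*$ with $B\ge 0$ (i.e. $Bx\ge0$ whenever $x\ge0$), $B(1,1,1,\dots)=1$, and $B(Tx)=Bx$ for all $x\in\ell_\infty$. $\mathfrak B$ is the set of all Banach limits. Continuous part: the space $N(T^*-I)=\{\varphi\in\ell_\infty^*:\varphi\circ T=\varphi\}$ of shift-invariant functionals is, with the norm and order inherited from $\ell_\infty^*$, an AL-space, hence lattice isometric to $L_1(\Omega)=L_1(\Omega_d)\oplus L_1(\Omega_c)$ for some measure space $\Omega=\Omega_d\cup\Omega_c$ partitioned into measurable subsets such that the measure is discrete (purely atomic) on $\Omega_d$ and continuous (atomless) on $\Omega_c$. The set $\mathfrak B$ is the positive part of the unit sphere of $N(T^*-I)$. $\mathfrak B_c$ is the set of those $B\in\mathfrak B$ which correspond to elements of $L_1(\Omega_c)$. In order terms, $\mathfrak B_c$ consists of the Banach limits lying in the disjoint complement of the band of $N(T^*-I)$ generated by its atoms. For a subset $M$ of a normed space $E$, the radius is $r(M,E)=\inf_{x\in M}\sup_{y\in M}\|x-y\|_E$. *)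

theory Defs
  imports "HOL-Analysis.Analysis"
begin

text \<open>
  As \<^typ>\<open>nat\<close> carries the discrete topology, the bounded continuous functions on it, with the
  sup norm, are exactly the bounded real sequences (indexed from 0). The norm of
  the type \<open>linfty_dual\<close> below is the operator norm, i.e. the dual norm.
\<close>

type_synonym linfty = "nat \<Rightarrow>\<^sub>C real"
type_synonym linfty_dual = "linfty \<Rightarrow>\<^sub>L real"

definition left_shift :: "linfty \<Rightarrow> linfty"
  where "left_shift x = Bcontfun (\<lambda>n. apply_bcontfun x (Suc n))"

lemma apply_left_shift [simp]: "apply_bcontfun (left_shift x) n = apply_bcontfun x (Suc n)"
proof -
  have "bounded (range (apply_bcontfun x))"
    using apply_bcontfun[of x] by (simp add: bcontfun_def)
  then have "bounded (range (\<lambda>n. apply_bcontfun x (Suc n)))"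
    by (rule bounded_subset) auto
  then have "(\<lambda>n. apply_bcontfun x (Suc n)) \<in> bcontfun"
    by (simp add: bcontfun_def)
  then show ?thesis
    by (simp add: left_shift_def Bcontfun_inverse)
qed

definition linfty_nonneg :: "linfty \<Rightarrow> bool"
  where "linfty_nonneg x \<longleftrightarrow> (\<forall>n. 0 \<le> apply_bcontfun x n)"

definition dual_le :: "linfty_dual \<Rightarrow> linfty_dual \<Rightarrow> bool"
  where "dual_le \<phi> \<psi> \<longleftrightarrow> (\<forall>x. linfty_nonneg x \<longrightarrow> blinfun_apply \<phi> x \<le> blinfun_apply \<psi> x)"

definition banach_limits :: "linfty_dual set"
  where "banach_limits = {B. dual_le 0 B \<and> blinfun_apply B (const_bcontfun 1) = 1 \<and>
           (\<forall>x. blinfun_apply B (left_shift x) = blinfun_apply B x)}"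

definition shift_invariant_functionals :: "linfty_dual set"
  where "shift_invariant_functionals =
           {\<phi>. \<forall>x. blinfun_apply \<phi> (left_shift x) = blinfun_apply \<phi> x}"


text \<open>
  Riesz space notions for a linear subspace \<open>E\<close> ordered by \<open>le\<close>. Suprema and infima are taken
  inside \<open>E\<close>. The definitions are meant for the case that \<open>E\<close> is a vector lattice, so that the
  suprema and infima of finite nonempty sets exist (and are unique).
\<close>

definition lub_in :: "'a set \<Rightarrow> ('a \<Rightarrow> 'a \<Rightarrow> bool) \<Rightarrow> 'a set \<Rightarrow> 'a \<Rightarrow> bool"
  where "lub_in E le S s \<longleftrightarrow> s \<in> E \<and> (\<forall>x\<in>S. le x s) \<and> (\<forall>u\<in>E. (\<forall>x\<in>S. le x u) \<longrightarrow> le s u)"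

definition glb_in :: "'a set \<Rightarrow> ('a \<Rightarrow> 'a \<Rightarrow> bool) \<Rightarrow> 'a set \<Rightarrow> 'a \<Rightarrow> bool"
  where "glb_in E le S i \<longleftrightarrow> i \<in> E \<and> (\<forall>x\<in>S. le i x) \<and> (\<forall>l\<in>E. (\<forall>x\<in>S. le l x) \<longrightarrow> le l i)"

text \<open>\<open>modulus_in E le x m\<close> says that \<open>m = \<bar>x\<bar> = x \<squnion> (- x)\<close> in \<open>E\<close>.\<close>

definition modulus_in :: "'a::real_vector set \<Rightarrow> ('a \<Rightarrow> 'a \<Rightarrow> bool) \<Rightarrow> 'a \<Rightarrow> 'a \<Rightarrow> bool"
  where "modulus_in E le x m \<longleftrightarrow> lub_in E le {x, - x} m"

text \<open>\<open>\<bar>x\<bar> \<sqinter> \<bar>y\<bar> = 0\<close>\<close>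

definition disjoint_in :: "'a::real_vector set \<Rightarrow> ('a \<Rightarrow> 'a \<Rightarrow> bool) \<Rightarrow> 'a \<Rightarrow> 'a \<Rightarrow> bool"
  where "disjoint_in E le x y \<longleftrightarrow>
           (\<exists>a b. modulus_in E le x a \<and> modulus_in E le y b \<and> glb_in E le {a, b} 0)"

definition disjoint_complement ::
    "'a::real_vector set \<Rightarrow> ('a \<Rightarrow> 'a \<Rightarrow> bool) \<Rightarrow> 'a set \<Rightarrow> 'a set"
  where "disjoint_complement E le A = {x\<in>E. \<forall>y\<in>A. disjoint_in E le x y}"

definition atoms_of :: "'a::real_vector set \<Rightarrow> ('a \<Rightarrow> 'a \<Rightarrow> bool) \<Rightarrow> 'a set"
  where "atoms_of E le =
           {a\<in>E. le 0 a \<and> a \<noteq> 0 \<and> (\<forall>b\<in>E. le 0 b \<and> le b a \<longrightarrow> (\<exists>c. b = c *\<^sub>R a))}"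

text \<open>A band is a solid linear subspace that contains every supremum existing in \<open>E\<close> of its
  subsets.\<close>

definition is_band :: "'a::real_vector set \<Rightarrow> ('a \<Rightarrow> 'a \<Rightarrow> bool) \<Rightarrow> 'a set \<Rightarrow> bool"
  where "is_band E le V \<longleftrightarrow>
           V \<subseteq> E \<and> subspace V \<and>
           (\<forall>x\<in>E. \<forall>y\<in>V. \<forall>a b. modulus_in E le x a \<and> modulus_in E le y b \<and> le a b \<longrightarrow> x \<in> V) \<and>
           (\<forall>S s. S \<subseteq> V \<and> lub_in E le S s \<longrightarrow> s \<in> V)"

definition band_generated :: "'a::real_vector set \<Rightarrow> ('a \<Rightarrow> 'a \<Rightarrow> bool) \<Rightarrow> 'a set \<Rightarrow> 'a set"
  where "band_generated E le A = \<Inter> {V. is_band E le V \<and> A \<subseteq> V}"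


text \<open>
  The shift-invariant functionals form an AL-space, hence are lattice isometric to
  \<open>L\<^sub>1(\<Omega>) = L\<^sub>1(\<Omega>\<^sub>d) \<oplus> L\<^sub>1(\<Omega>\<^sub>c)\<close> with \<open>\<Omega>\<^sub>d\<close> purely atomic and \<open>\<Omega>\<^sub>c\<close> atomless. The summand
  \<open>L\<^sub>1(\<Omega>\<^sub>d)\<close> corresponds to the band generated by the atoms and \<open>L\<^sub>1(\<Omega>\<^sub>c)\<close> to its disjoint
  complement, so the following are the Banach limits represented in \<open>L\<^sub>1(\<Omega>\<^sub>c)\<close>.
\<close>

definition continuous_banach_limits :: "linfty_dual set"
  where "continuous_banach_limits =
           banach_limits \<inter>
           disjoint_complement shift_invariant_functionals dual_le
             (band_generated shift_invariant_functionals dual_le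
               (atoms_of shift_invariant_functionals dual_le))"

text \<open>Extended reals make the infimum and the suprema meaningful for arbitrary sets, including
  unbounded ones (infinite supremum) and the empty set (radius \<open>\<infinity>\<close>).\<close>

definition radius :: "'a::real_normed_vector set \<Rightarrow> ereal"
  where "radius M = (INF x\<in>M. SUP y\<in>M. ereal (norm (x - y)))"

end

theory Submission
  imports Defs "HOL-Library.Discrete_Functions"
begin

text \<open>
  Cut the index set into the blocks \<open>{m\<^sup>2..<(m + 1)\<^sup>2}\<close>. Invariant functionals do not see the squares,
  hence the restriction of an invariant positive functional to a union of blocks is again invariant. So
  an atom lives on a single residue class modulo \<open>M\<close> of blocks, for every \<open>M\<close>, and a Banach limit
  whose masses on the residue classes modulo \<open>M\<close> tend to \<open>0\<close> uniformly as \<open>M \<rightarrow> \<infinity>\<close> is disjoint from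
  all atoms. A cluster point of averages over \<open>n + 1\<close> initial parts of blocks is a Banach limit that
  has mass \<open>1/M\<close> on each residue class modulo \<open>M\<close>. Its normalized restrictions to the \<open>N\<close> residue
  classes modulo \<open>N\<close> are \<open>N\<close> continuous Banach limits that live on disjoint sets, and any given
  Banach limit \<open>B\<close> has mass at most \<open>1/N\<close> on one of these sets, so its distance from the
  corresponding restriction is at least \<open>2 - 2/N\<close>.
\<close>

abbreviation unit_seq :: linfty
  where "unit_seq \<equiv> const_bcontfun 1"

notation shift_invariant_functionals (\<open>\<S>\<close>)
notation dual_le (infix \<open>\<preceq>\<close> 50)

subsection \<open>The ordered space of bounded sequences and its dual\<close>

lemma apply_Bcontfun_nat:
  fixes f :: "nat \<Rightarrow> real"
  assumes "\<And>n. \<bar>f n\<bar> \<le> K"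
  shows "apply_bcontfun (Bcontfun f) = f"
  using bcontfun_normI[of f K] assms by (simp add: Bcontfun_inverse continuous_on_discrete)

lemma linfty_abs_le: "\<bar>apply_bcontfun x n\<bar> \<le> norm x" for x :: linfty
  using norm_bounded[of x n] by simp

lemma linfty_nonneg_simps [simp]:
  "linfty_nonneg 0" "linfty_nonneg unit_seq"
  "linfty_nonneg x \<Longrightarrow> linfty_nonneg y \<Longrightarrow> linfty_nonneg (x + y)"
  "linfty_nonneg x \<Longrightarrow> 0 \<le> c \<Longrightarrow> linfty_nonneg (c *\<^sub>R x)"
  "linfty_nonneg x \<Longrightarrow> linfty_nonneg (left_shift x)"
  by (auto simp: linfty_nonneg_def const_bcontfun.rep_eq)

lemma linfty_nonneg_add_norm: "norm x \<le> c \<Longrightarrow> linfty_nonneg (c *\<^sub>R unit_seq + x)"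
  and linfty_nonneg_diff_norm: "norm x \<le> c \<Longrightarrow> linfty_nonneg (c *\<^sub>R unit_seq - x)"
  using linfty_abs_le[of x]
  by (auto simp: linfty_nonneg_def const_bcontfun.rep_eq intro: order_trans abs_le_D1)
    (smt (verit))+

lemma norm_le_of_nonneg:
  assumes "linfty_nonneg y" "linfty_nonneg (x - y)"
  shows "norm y \<le> norm x"
proof (rule norm_bound)
  fix n
  show "norm (apply_bcontfun y n) \<le> norm x"
    using assms linfty_abs_le[of x n] by (auto simp: linfty_nonneg_def dest!: spec[of _ n])
qed

lemma left_shift_simps [simp]:
  "left_shift (x + y) = left_shift x + left_shift y"
  "left_shift (c *\<^sub>R x) = c *\<^sub>R left_shift x"
  "left_shift unit_seq = unit_seq"
  by (auto intro!: bcontfun_eqI simp: const_bcontfun.rep_eq)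

text \<open>Both x and -x lie below the multiple of \<open>unit_seq\<close> by the norm of x, so
  positivity alone bounds f by its value at \<open>unit_seq\<close>.\<close>

lemma positive_linear_imp_bounded_linear:
  fixes f :: "linfty \<Rightarrow> real"
  assumes "linear f" "\<And>x. linfty_nonneg x \<Longrightarrow> 0 \<le> f x"
  shows "bounded_linear f"
proof -
  have "norm (f x) \<le> norm x * f unit_seq" for x
    using assms(2)[OF linfty_nonneg_add_norm[of x "norm x"]]
      assms(2)[OF linfty_nonneg_diff_norm[of x "norm x"]]
    by (simp add: linear_add[OF assms(1)] linear_diff[OF assms(1)] linear_scale[OF assms(1)] abs_le_iff)
  then show ?thesis
    using assms(1) by (intro bounded_linear.intro bounded_linear_axioms.intro) auto
qed

text \<open>Adding a large enough multiple of \<open>unit_seq\<close> moves any x into the positive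
  cone. The extension evaluates f there and subtracts f of the multiple; \<open>g_eq\<close> shows
  that the choice of the multiple does not matter, which gives additivity.\<close>

lemma positive_functional_extension:
  fixes f :: "linfty \<Rightarrow> real"
  assumes add: "\<And>x y. linfty_nonneg x \<Longrightarrow> linfty_nonneg y \<Longrightarrow> f (x + y) = f x + f y"
    and scale: "\<And>c x. 0 \<le> c \<Longrightarrow> linfty_nonneg x \<Longrightarrow> f (c *\<^sub>R x) = c * f x"
    and nonneg: "\<And>x. linfty_nonneg x \<Longrightarrow> 0 \<le> f x"
  obtains \<phi> :: linfty_dual where "\<And>x. linfty_nonneg x \<Longrightarrow> \<phi> x = f x"
proof -
  define g where "g x = f (norm x *\<^sub>R unit_seq + x) - norm x * f unit_seq" for x
  have g_eq: "g x = f (c *\<^sub>R unit_seq + x) - c * f unit_seq" if "norm x \<le> c" for x c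
  proof -
    have "0 \<le> c" using that norm_ge_zero order_trans by blast
    have "f (d *\<^sub>R unit_seq + (e *\<^sub>R unit_seq + x)) = d * f unit_seq + f (e *\<^sub>R unit_seq + x)"
      if "0 \<le> d" "norm x \<le> e" for d e
      using that by (simp add: add scale linfty_nonneg_add_norm)
    from this[of c "norm x"] this[of "norm x" c] \<open>0 \<le> c\<close> that show ?thesis
      by (simp add: g_def algebra_simps)
  qed
  have g_nonneg: "g x = f x" if "linfty_nonneg x" for x
    using that by (simp add: g_def add scale)
  have g_add: "g (x + y) = g x + g y" for x y
  proof -
    have "f ((norm x + norm y) *\<^sub>R unit_seq + (x + y))
        = f (norm x *\<^sub>R unit_seq + x) + f (norm y *\<^sub>R unit_seq + y)"
      using add[OF linfty_nonneg_add_norm[OF order_refl, of x] linfty_nonneg_add_norm[OF order_refl, of y]]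
      by (simp add: algebra_simps)
    then show ?thesis
      using g_eq[OF norm_triangle_ineq[of x y]] by (simp add: g_def algebra_simps)
  qed
  have g_scale: "g (c *\<^sub>R x) = c * g x" if "0 \<le> c" for c x
    using that scale[OF that linfty_nonneg_add_norm[of x "norm x"]]
    by (simp add: g_def algebra_simps)
  have "g (- x) = - g x" for x
    using g_add[of x "- x"] g_nonneg[of 0] scale[of 0 0] by simp
  then have "g (c *\<^sub>R x) = c * g x" for c x
    using g_scale[of c x] g_scale[of "- c" x] by (cases "0 \<le> c") (auto simp: minus_equation_iff)
  then have "linear g"
    by (intro linearI) (auto simp: g_add)
  then have "bounded_linear g"
    by (rule positive_linear_imp_bounded_linear) (simp add: g_nonneg nonneg)
  then show thesis
    using that[of "Blinfun g"] by (simp add: bounded_linear_Blinfun_apply g_nonneg)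
qed

lemma dual_nonneg_abs_le:
  fixes \<phi> :: linfty_dual
  assumes "0 \<preceq> \<phi>"
  shows "\<bar>\<phi> x\<bar> \<le> norm x * \<phi> unit_seq"
proof -
  have "0 \<le> \<phi> (norm x *\<^sub>R unit_seq + x)" "0 \<le> \<phi> (norm x *\<^sub>R unit_seq - x)"
    using assms linfty_nonneg_add_norm[of x "norm x"] linfty_nonneg_diff_norm[of x "norm x"]
    by (auto simp: dual_le_def)
  then show ?thesis
    by (simp add: blinfun.bilinear_simps abs_le_iff)
qed

text \<open>As \<open>unit_seq\<close> is an order unit, a positive functional is controlled by its
  value there. Equality of comparable functionals thus reduces to comparing one number.\<close>

lemma dual_nonneg_eq_zero: "0 \<preceq> \<phi> \<Longrightarrow> \<phi> unit_seq \<le> 0 \<Longrightarrow> \<phi> = 0" for \<phi> :: linfty_dual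
  by (rule blinfun_eqI)
    (smt (verit) dual_nonneg_abs_le mult_nonneg_nonpos norm_ge_zero blinfun.zero_left)

lemma dual_le_refl [simp]: "\<phi> \<preceq> \<phi>"
  by (simp add: dual_le_def)

lemma dual_le_trans: "\<phi> \<preceq> \<psi> \<Longrightarrow> \<psi> \<preceq> \<theta> \<Longrightarrow> \<phi> \<preceq> \<theta>"
  by (force simp: dual_le_def)

lemma dual_le_antisym:
  assumes "\<phi> \<preceq> \<psi>" "\<psi> \<preceq> \<phi>"
  shows "\<phi> = \<psi>"
proof -
  have "\<psi> - \<phi> = 0"
    using assms
    by (intro dual_nonneg_eq_zero) (auto simp: dual_le_def blinfun.bilinear_simps)
  then show ?thesis by simp
qed

lemma shift_invariant_functionalsI: "(\<And>x. \<phi> (left_shift x) = \<phi> x) \<Longrightarrow> \<phi> \<in> \<S>" for \<phi> :: linfty_dual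
  by (simp add: shift_invariant_functionals_def)

lemma shift_invariantD: "\<phi> \<in> \<S> \<Longrightarrow> \<phi> (left_shift x) = \<phi> x" for \<phi> :: linfty_dual
  by (simp add: shift_invariant_functionals_def)

lemma subspace_shift_invariant_functionals: "subspace \<S>"
  by (auto simp: subspace_def shift_invariant_functionals_def blinfun.bilinear_simps)

lemmas shift_invariant_closed [simp] =
  subspace_0[OF subspace_shift_invariant_functionals]
  subspace_add[OF subspace_shift_invariant_functionals]
  subspace_diff[OF subspace_shift_invariant_functionals]
  subspace_neg[OF subspace_shift_invariant_functionals]
  subspace_scale[OF subspace_shift_invariant_functionals]

subsection \<open>Positive parts and moduli\<close>

text \<open>The Riesz-Kantorovich formula: for nonnegative x, the value at x of the positive part of
  \<phi> in the whole dual.\<close>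

definition riesz_kantorovich :: "linfty_dual \<Rightarrow> linfty \<Rightarrow> real"
  where "riesz_kantorovich \<phi> x = (SUP y\<in>{y. linfty_nonneg y \<and> linfty_nonneg (x - y)}. \<phi> y)"

lemma riesz_kantorovich_upper:
  fixes \<phi> :: linfty_dual
  assumes "linfty_nonneg y" "linfty_nonneg (x - y)"
  shows "\<phi> y \<le> riesz_kantorovich \<phi> x"
  unfolding riesz_kantorovich_def
proof (rule cSUP_upper)
  show "bdd_above (\<phi> ` {y. linfty_nonneg y \<and> linfty_nonneg (x - y)})"
  proof (rule bdd_aboveI2)
    fix y assume "y \<in> {y. linfty_nonneg y \<and> linfty_nonneg (x - y)}"
    then have "norm (\<phi> y) \<le> norm \<phi> * norm x"
      using norm_blinfun[of \<phi> y] norm_le_of_nonneg[of y x]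
      by (simp add: order_trans mult_left_mono)
    then show "\<phi> y \<le> norm \<phi> * norm x" by simp
  qed
qed (use assms in simp)

lemma riesz_kantorovich_least:
  fixes \<phi> :: linfty_dual
  assumes "linfty_nonneg x" "\<And>y. linfty_nonneg y \<Longrightarrow> linfty_nonneg (x - y) \<Longrightarrow> \<phi> y \<le> c"
  shows "riesz_kantorovich \<phi> x \<le> c"
  unfolding riesz_kantorovich_def
  by (rule cSUP_least) (use assms in \<open>auto intro: exI[of _ 0]\<close>)

text \<open>For the upper bound, Riesz decomposition: z in the order interval [0, x + y] splits into
  the coordinatewise minimum of z and x, which lies in [0, x], and a rest in [0, y].\<close>

lemma riesz_kantorovich_add:
  assumes x: "linfty_nonneg x" and y: "linfty_nonneg y"
  shows "riesz_kantorovich \<phi> (x + y) = riesz_kantorovich \<phi> x + riesz_kantorovich \<phi> y"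
proof (rule antisym)
  show "riesz_kantorovich \<phi> (x + y) \<le> riesz_kantorovich \<phi> x + riesz_kantorovich \<phi> y"
  proof (rule riesz_kantorovich_least)
    fix z assume z: "linfty_nonneg z" "linfty_nonneg (x + y - z)"
    define u where "u = Bcontfun (\<lambda>n. min (apply_bcontfun z n) (apply_bcontfun x n))"
    have u: "apply_bcontfun u n = min (apply_bcontfun z n) (apply_bcontfun x n)" for n
      unfolding u_def
      by (subst apply_Bcontfun_nat[where K = "norm z + norm x"])
        (use linfty_abs_le[of z] linfty_abs_le[of x] in \<open>auto simp: min_def add_increasing add_increasing2\<close>)
    have "\<phi> u \<le> riesz_kantorovich \<phi> x"
      by (rule riesz_kantorovich_upper) (use x z in \<open>auto simp: linfty_nonneg_def u\<close>)
    moreover have "\<phi> (z - u) \<le> riesz_kantorovich \<phi> y"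
      by (rule riesz_kantorovich_upper)
        (use y z in \<open>auto simp: linfty_nonneg_def u min_def algebra_simps\<close>)
    ultimately show "\<phi> z \<le> riesz_kantorovich \<phi> x + riesz_kantorovich \<phi> y"
      by (simp add: blinfun.bilinear_simps)
  qed (use x y in simp)
  have "\<phi> u + \<phi> v \<le> riesz_kantorovich \<phi> (x + y)"
    if "linfty_nonneg u" "linfty_nonneg (x - u)" "linfty_nonneg v" "linfty_nonneg (y - v)" for u v
    using that riesz_kantorovich_upper[of "u + v" "x + y" \<phi>] linfty_nonneg_simps(3)[of "x - u" "y - v"]
    by (simp add: blinfun.bilinear_simps add_diff_add)
  then have "riesz_kantorovich \<phi> x \<le> riesz_kantorovich \<phi> (x + y) - \<phi> v"
    if "linfty_nonneg v" "linfty_nonneg (y - v)" for v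
    using that by (intro riesz_kantorovich_least[OF x]) (simp add: le_diff_eq)
  then have "riesz_kantorovich \<phi> y \<le> riesz_kantorovich \<phi> (x + y) - riesz_kantorovich \<phi> x"
    by (intro riesz_kantorovich_least[OF y]) (simp add: le_diff_eq add.commute)
  then show "riesz_kantorovich \<phi> x + riesz_kantorovich \<phi> y \<le> riesz_kantorovich \<phi> (x + y)"
    by simp
qed

lemma riesz_kantorovich_scale:
  assumes "0 \<le> c" "linfty_nonneg x"
  shows "riesz_kantorovich \<phi> (c *\<^sub>R x) = c * riesz_kantorovich \<phi> x"
proof (cases "c = 0")
  case True
  then show ?thesis
    using riesz_kantorovich_add[of 0 0 \<phi>] by simp
next
  case False
  have le: "c * riesz_kantorovich \<phi> x \<le> riesz_kantorovich \<phi> (c *\<^sub>R x)"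
    if "0 < c" "linfty_nonneg x" for c x
  proof -
    have "riesz_kantorovich \<phi> x \<le> riesz_kantorovich \<phi> (c *\<^sub>R x) / c"
    proof (rule riesz_kantorovich_least)
      fix y assume "linfty_nonneg y" "linfty_nonneg (x - y)"
      then have "\<phi> (c *\<^sub>R y) \<le> riesz_kantorovich \<phi> (c *\<^sub>R x)"
        using that by (intro riesz_kantorovich_upper) (simp_all flip: scaleR_right_diff_distrib)
      then show "\<phi> y \<le> riesz_kantorovich \<phi> (c *\<^sub>R x) / c"
        using that(1) by (simp add: blinfun.scaleR_right pos_le_divide_eq mult.commute)
    qed (fact that)
    then show ?thesis using that by (simp add: field_simps)
  qed
  from False assms have c: "0 < c" by simp
  have "riesz_kantorovich \<phi> (c *\<^sub>R x) \<le> c * riesz_kantorovich \<phi> x"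
    using le[of "1 / c" "c *\<^sub>R x"] c assms by (simp add: field_simps)
  with le[OF c assms(2)] show ?thesis by simp
qed

lemma riesz_kantorovich_nonneg: "linfty_nonneg x \<Longrightarrow> 0 \<le> riesz_kantorovich \<phi> x"
  using riesz_kantorovich_upper[of 0 x \<phi>] by simp

text \<open>The positive part \<open>p\<close> of an invariant \<open>\<phi>\<close> is invariant: \<open>p \<circ> T\<close> dominates \<open>0\<close> and \<open>\<phi>\<close>,
  hence \<open>p\<close>, and agrees with \<open>p\<close> on the constant sequences.\<close>

lemma ex_positive_part:
  assumes "\<phi> \<in> \<S>"
  shows "\<exists>p. lub_in \<S> (\<preceq>) {0, \<phi>} p"
proof -
  obtain p :: linfty_dual where p: "\<And>x. linfty_nonneg x \<Longrightarrow> p x = riesz_kantorovich \<phi> x"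
    using positive_functional_extension[of "riesz_kantorovich \<phi>"]
    by (metis riesz_kantorovich_add riesz_kantorovich_scale riesz_kantorovich_nonneg)
  have p0: "0 \<preceq> p"
    by (simp add: dual_le_def p riesz_kantorovich_nonneg)
  have p\<phi>: "\<phi> \<preceq> p"
    by (simp add: dual_le_def p riesz_kantorovich_upper)
  have p_least: "p \<preceq> u" if "0 \<preceq> u" "\<phi> \<preceq> u" for u
    unfolding dual_le_def
  proof (intro allI impI)
    fix x assume "linfty_nonneg x"
    moreover have "\<phi> y \<le> u x" if "linfty_nonneg y" "linfty_nonneg (x - y)" for y
    proof -
      have "\<phi> y \<le> u y" "0 \<le> u (x - y)"
        using that \<open>0 \<preceq> u\<close> \<open>\<phi> \<preceq> u\<close> by (auto simp: dual_le_def)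
      then show ?thesis by (simp add: blinfun.bilinear_simps)
    qed
    ultimately show "p x \<le> u x"
      by (simp add: p riesz_kantorovich_least)
  qed
  have "bounded_linear (\<lambda>x. p (left_shift x))"
  proof (rule positive_linear_imp_bounded_linear)
    show "linear (\<lambda>x. p (left_shift x))"
      by (intro linearI) (simp_all add: blinfun.bilinear_simps)
  qed (use p0 in \<open>auto simp: dual_le_def\<close>)
  then obtain q :: linfty_dual where q: "\<And>x. q x = p (left_shift x)"
    by (metis bounded_linear_Blinfun_apply)
  have "p \<preceq> q"
  proof (rule p_least)
    show "0 \<preceq> q"
      using p0 by (simp add: dual_le_def q)
    have "\<phi> x \<le> q x" if "linfty_nonneg x" for x
      using p\<phi> linfty_nonneg_simps(5)[OF that] shift_invariantD[OF assms, of x]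
      by (fastforce simp: dual_le_def q)
    then show "\<phi> \<preceq> q"
      by (simp add: dual_le_def)
  qed
  then have "q - p = 0"
    by (intro dual_nonneg_eq_zero) (auto simp: dual_le_def q blinfun.bilinear_simps)
  then have "p \<in> \<S>"
    by (intro shift_invariant_functionalsI) (simp flip: q)
  with p0 p\<phi> p_least show ?thesis
    by (auto simp: lub_in_def)
qed

definition pos_part :: "linfty_dual \<Rightarrow> linfty_dual"
  where "pos_part \<phi> = (SOME p. lub_in \<S> (\<preceq>) {0, \<phi>} p)"

lemma pos_part:
  assumes "\<phi> \<in> \<S>"
  shows "pos_part \<phi> \<in> \<S>" "0 \<preceq> pos_part \<phi>" "\<phi> \<preceq> pos_part \<phi>"
    "\<And>u. u \<in> \<S> \<Longrightarrow> 0 \<preceq> u \<Longrightarrow> \<phi> \<preceq> u \<Longrightarrow> pos_part \<phi> \<preceq> u"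
  using someI_ex[OF ex_positive_part[OF assms]] by (auto simp: lub_in_def pos_part_def)

text \<open>The modulus is the sum of the positive part and the negative part, and the latter is the
  positive part minus \<phi>.\<close>

definition dual_abs :: "linfty_dual \<Rightarrow> linfty_dual"
  where "dual_abs \<phi> = 2 *\<^sub>R pos_part \<phi> - \<phi>"

lemma dual_abs_in [simp]: "\<phi> \<in> \<S> \<Longrightarrow> dual_abs \<phi> \<in> \<S>"
  by (simp add: dual_abs_def pos_part)

lemma dual_abs_ge:
  assumes "\<phi> \<in> \<S>"
  shows "\<phi> \<preceq> dual_abs \<phi>" "- \<phi> \<preceq> dual_abs \<phi>" "0 \<preceq> dual_abs \<phi>"
  using pos_part(2,3)[OF assms] by (force simp: dual_le_def dual_abs_def blinfun.bilinear_simps)+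

text \<open>If u dominates \<phi> and -\<phi>, then half of u + \<phi> dominates 0 and \<phi>, hence
  the positive part.\<close>

lemma dual_abs_least:
  assumes "\<phi> \<in> \<S>" "u \<in> \<S>" "\<phi> \<preceq> u" "- \<phi> \<preceq> u"
  shows "dual_abs \<phi> \<preceq> u"
proof -
  have "pos_part \<phi> \<preceq> (1/2) *\<^sub>R (u + \<phi>)"
    using assms by (intro pos_part) (force simp: dual_le_def blinfun.bilinear_simps)+
  then show ?thesis
    by (auto simp: dual_le_def dual_abs_def blinfun.bilinear_simps)
qed

lemma modulus_in_iff: "\<phi> \<in> \<S> \<Longrightarrow> modulus_in \<S> (\<preceq>) \<phi> m \<longleftrightarrow> m = dual_abs \<phi>"
proof -
  assume \<phi>: "\<phi> \<in> \<S>"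
  have "modulus_in \<S> (\<preceq>) \<phi> (dual_abs \<phi>)"
    using \<phi> by (simp add: modulus_in_def lub_in_def dual_abs_ge dual_abs_least)
  then show ?thesis
    unfolding modulus_in_def lub_in_def by (metis dual_le_antisym)
qed

lemma dual_abs_nonneg:
  assumes \<phi>: "\<phi> \<in> \<S>" "0 \<preceq> \<phi>"
  shows "dual_abs \<phi> = \<phi>"
proof (rule dual_le_antisym)
  have "- \<phi> \<preceq> \<phi>"
    using \<phi>(2) by (force simp: dual_le_def blinfun.bilinear_simps)
  then show "dual_abs \<phi> \<preceq> \<phi>"
    using \<phi>(1) by (intro dual_abs_least) auto
qed (rule dual_abs_ge(1)[OF \<phi>(1)])

subsection \<open>The functionals disjoint from a positive one form a band\<close>

text \<open>It suffices to test positive w: since B and the modulus of \<phi> are nonnegative, the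
  positive part of a common lower bound is again a common lower bound.\<close>

lemma disjoint_in_iff:
  assumes B: "B \<in> \<S>" "0 \<preceq> B" and \<phi>: "\<phi> \<in> \<S>"
  shows "disjoint_in \<S> (\<preceq>) B \<phi> \<longleftrightarrow>
    (\<forall>w\<in>\<S>. 0 \<preceq> w \<longrightarrow> w \<preceq> B \<longrightarrow> w \<preceq> dual_abs \<phi> \<longrightarrow> w = 0)" (is "_ \<longleftrightarrow> ?R")
proof -
  have "disjoint_in \<S> (\<preceq>) B \<phi> \<longleftrightarrow>
      (\<forall>w\<in>\<S>. w \<preceq> B \<longrightarrow> w \<preceq> dual_abs \<phi> \<longrightarrow> w \<preceq> 0)"
    using modulus_in_iff[OF B(1)] modulus_in_iff[OF \<phi>] dual_abs_nonneg[OF B]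
      B(2) dual_abs_ge(3)[OF \<phi>]
    by (simp add: disjoint_in_def glb_in_def) blast
  also have "\<dots> \<longleftrightarrow> ?R"
  proof
    assume R: ?R
    show "\<forall>w\<in>\<S>. w \<preceq> B \<longrightarrow> w \<preceq> dual_abs \<phi> \<longrightarrow> w \<preceq> 0"
    proof (intro ballI impI)
      fix w assume w: "w \<in> \<S>" "w \<preceq> B" "w \<preceq> dual_abs \<phi>"
      then have "pos_part w = 0"
        using R B \<phi> by (simp add: pos_part dual_abs_ge)
      then show "w \<preceq> 0" using pos_part(3)[OF w(1)] by simp
    qed
  qed (blast intro: dual_le_antisym)
  finally show ?thesis .
qed

lemma disjoint_inD:
  assumes "disjoint_in \<S> (\<preceq>) B \<phi>" "B \<in> \<S>" "0 \<preceq> B" "\<phi> \<in> \<S>"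
    and "w \<in> \<S>" "0 \<preceq> w" "w \<preceq> B" "w \<preceq> dual_abs \<phi>"
  shows "w = 0"
  using assms disjoint_in_iff by blast

text \<open>Closure under suprema: if \<open>s = sup S\<close> and \<open>w\<close> lies below \<open>B\<close> and \<open>s\<^sup>+\<close>, then \<open>s\<^sup>+ - w\<close> is
  still an upper bound of \<open>S\<close>, because \<open>x\<^sup>+ + w = x\<^sup>+ \<squnion> w\<close> for \<open>x \<in> S\<close>.\<close>

lemma is_band_disjoint:
  assumes B: "B \<in> \<S>" "0 \<preceq> B"
  shows "is_band \<S> (\<preceq>) {\<phi>\<in>\<S>. disjoint_in \<S> (\<preceq>) B \<phi>}" (is "is_band _ _ ?V")
proof -
  note iff = disjoint_in_iff[OF B]
  have solid: "\<phi> \<in> ?V" if "\<phi> \<in> \<S>" "\<psi> \<in> ?V" "dual_abs \<phi> \<preceq> dual_abs \<psi>" for \<phi> \<psi>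
    using that by (simp add: iff) (blast intro: disjoint_inD[OF _ B] dual_le_trans)
  \<comment> \<open>If a and b are disjoint from B, so is a + b: the positive part of w - a lies
    below w and b, so it vanishes. Then w is below a and vanishes too.\<close>
  have below_sum: "w = 0"
    if "w \<in> \<S>" "0 \<preceq> w" "w \<preceq> B" "w \<preceq> a + b" "a \<in> \<S>" "b \<in> \<S>" "0 \<preceq> a" "0 \<preceq> b"
      and a: "\<And>v. v \<in> \<S> \<Longrightarrow> 0 \<preceq> v \<Longrightarrow> v \<preceq> B \<Longrightarrow> v \<preceq> a \<Longrightarrow> v = 0"
      and b: "\<And>v. v \<in> \<S> \<Longrightarrow> 0 \<preceq> v \<Longrightarrow> v \<preceq> B \<Longrightarrow> v \<preceq> b \<Longrightarrow> v = 0"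
    for w a b
  proof -
    let ?v = "pos_part (w - a)"
    have wa: "w - a \<in> \<S>" using that by simp
    have "w - a \<preceq> w" "w - a \<preceq> b"
      using that by (auto simp: dual_le_def blinfun.bilinear_simps algebra_simps)
    then have "?v \<preceq> w" "?v \<preceq> b"
      using that wa by (auto intro!: pos_part(4))
    then have "?v = 0"
      using b pos_part[OF wa] dual_le_trans \<open>w \<preceq> B\<close> by blast
    then have "w \<preceq> a"
      using pos_part(3)[OF wa] by (auto simp: dual_le_def blinfun.bilinear_simps)
    then show "w = 0" using a that by blast
  qed
  have "subspace ?V"
  proof (rule subspaceI)
    show "0 \<in> ?V"
      using iff[of 0] by (simp add: dual_abs_nonneg) (blast intro: dual_le_antisym)
  next
    fix \<phi> \<psi> assume "\<phi> \<in> ?V" "\<psi> \<in> ?V"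
    then have \<phi>: "\<phi> \<in> \<S>" "disjoint_in \<S> (\<preceq>) B \<phi>" and \<psi>: "\<psi> \<in> \<S>" "disjoint_in \<S> (\<preceq>) B \<psi>"
      by auto
    have "dual_abs (\<phi> + \<psi>) \<preceq> dual_abs \<phi> + dual_abs \<psi>"
    proof (rule dual_abs_least)
      show "\<phi> + \<psi> \<preceq> dual_abs \<phi> + dual_abs \<psi>"
        using dual_abs_ge(1)[OF \<phi>(1)] dual_abs_ge(1)[OF \<psi>(1)]
        by (auto simp: dual_le_def blinfun.bilinear_simps add_mono)
      show "- (\<phi> + \<psi>) \<preceq> dual_abs \<phi> + dual_abs \<psi>"
        using dual_abs_ge(2)[OF \<phi>(1)] dual_abs_ge(2)[OF \<psi>(1)]
        by (force simp: dual_le_def blinfun.bilinear_simps)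
    qed (use \<phi> \<psi> in auto)
    then have "w = 0" if "w \<in> \<S>" "0 \<preceq> w" "w \<preceq> B" "w \<preceq> dual_abs (\<phi> + \<psi>)" for w
      using that(1-3) dual_le_trans[OF that(4)]
        dual_abs_in[OF \<phi>(1)] dual_abs_ge(3)[OF \<phi>(1)] disjoint_inD[OF \<phi>(2) B \<phi>(1)]
        dual_abs_in[OF \<psi>(1)] dual_abs_ge(3)[OF \<psi>(1)] disjoint_inD[OF \<psi>(2) B \<psi>(1)]
      by (intro below_sum[of w "dual_abs \<phi>" "dual_abs \<psi>"])
    then show "\<phi> + \<psi> \<in> ?V" using \<phi> \<psi> by (simp add: iff)
  next
    fix c :: real and \<phi> assume "\<phi> \<in> ?V"
    then have \<phi>: "\<phi> \<in> \<S>" "disjoint_in \<S> (\<preceq>) B \<phi>" by auto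
    \<comment> \<open>With d at least 1, scaling w by 1/d keeps it below B, and c = 0 needs no
      separate treatment.\<close>
    define d where "d = 1 + \<bar>c\<bar>"
    have d: "1 \<le> d" "\<bar>c\<bar> \<le> d" by (auto simp: d_def)
    have "\<bar>c * \<phi> x\<bar> \<le> d * dual_abs \<phi> x" if "linfty_nonneg x" for x
      unfolding abs_mult using dual_abs_ge[OF \<phi>(1)] that d
      by (intro mult_mono) (auto simp: dual_le_def blinfun.bilinear_simps abs_le_iff)
    then have le: "dual_abs (c *\<^sub>R \<phi>) \<preceq> d *\<^sub>R dual_abs \<phi>"
      using \<phi> by (intro dual_abs_least) (auto simp: dual_le_def blinfun.bilinear_simps abs_le_iff)
    have "w = 0" if w: "w \<in> \<S>" "0 \<preceq> w" "w \<preceq> B" "w \<preceq> dual_abs (c *\<^sub>R \<phi>)" for w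
    proof -
      have "w \<preceq> d *\<^sub>R dual_abs \<phi>"
        using w(4) le by (rule dual_le_trans)
      then have 1: "(1 / d) *\<^sub>R w \<preceq> dual_abs \<phi>"
        using d by (auto simp: dual_le_def blinfun.bilinear_simps field_simps)
      have 2: "(1 / d) *\<^sub>R w \<preceq> w" "0 \<preceq> (1 / d) *\<^sub>R w"
        using d w(2) by (auto simp: dual_le_def blinfun.bilinear_simps divide_le_eq mult_le_cancel_left1)
      have "(1 / d) *\<^sub>R w = 0"
        by (rule disjoint_inD[OF \<phi>(2) B \<phi>(1)]) (use w(1) 1 2 dual_le_trans[OF 2(1) w(3)] in simp_all)
      then show ?thesis using d by auto
    qed
    then show "c *\<^sub>R \<phi> \<in> ?V" using \<phi> by (simp add: iff)
  qed
  moreover have "s \<in> ?V" if S: "S \<subseteq> ?V" and s: "lub_in \<S> (\<preceq>) S s" for S s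
  proof -
    have sS: "s \<in> \<S>" and ub: "\<And>x. x \<in> S \<Longrightarrow> x \<preceq> s"
      and least: "\<And>u. u \<in> \<S> \<Longrightarrow> (\<And>x. x \<in> S \<Longrightarrow> x \<preceq> u) \<Longrightarrow> s \<preceq> u"
      using s by (auto simp: lub_in_def)
    note ps = pos_part[OF sS]
    have pos: "w = 0" if w: "w \<in> \<S>" "0 \<preceq> w" "w \<preceq> B" "w \<preceq> pos_part s" for w
    proof -
      have "x \<preceq> pos_part s - w" if "x \<in> S" for x
      proof -
        have x: "x \<in> \<S>" "disjoint_in \<S> (\<preceq>) B x" using that S by auto
        \<comment> \<open>\<open>?v\<close> lies below w and below the positive part of x, so
          disjointness of B and x kills it. This says that w plus the positive part of x stays below
          the positive part of s.\<close>
        let ?d = "pos_part s - pos_part x"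
        let ?v = "pos_part (w - ?d)"
        have wd: "w - ?d \<in> \<S>" using w x sS by (simp add: pos_part)
        have "pos_part x \<preceq> pos_part s"
          using ps(1,2) dual_le_trans[OF ub[OF that] ps(3)] by (intro pos_part(4)[OF x(1)])
        then have "w - ?d \<preceq> w" "w - ?d \<preceq> pos_part x"
          using w(4) by (auto simp: dual_le_def blinfun.bilinear_simps algebra_simps)
        moreover have "pos_part x \<preceq> dual_abs x"
          using x(1) by (intro pos_part(4)) (auto simp: dual_abs_ge)
        ultimately have "w - ?d \<preceq> w" "w - ?d \<preceq> dual_abs x"
          using dual_le_trans by blast+
        then have "?v \<preceq> w" "?v \<preceq> dual_abs x"
          using w(1,2) x(1) by (auto intro!: pos_part(4)[OF wd] dual_abs_ge)
        then have "?v = 0"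
          using disjoint_inD[OF x(2) B x(1)] pos_part[OF wd] w(3) dual_le_trans by blast
        then have "w \<preceq> ?d"
          using pos_part(3)[OF wd] by (auto simp: dual_le_def blinfun.bilinear_simps)
        then show ?thesis
          using pos_part(3)[OF x(1)] by (force simp: dual_le_def blinfun.bilinear_simps)
      qed
      then have "s \<preceq> pos_part s - w"
        using w ps by (intro least) auto
      then have "pos_part s \<preceq> pos_part s - w"
        using w ps by (intro ps(4)) (auto simp: dual_le_def blinfun.bilinear_simps)
      then have "w \<preceq> 0"
        by (auto simp: dual_le_def blinfun.bilinear_simps)
      then show ?thesis using w(2) by (rule dual_le_antisym)
    qed
    show ?thesis
    proof (cases "S = {}")
      \<comment> \<open>A supremum of the empty set is a least element of the space; comparing it
        with 0 and with its own double forces it to be 0.\<close>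
      case True
      have "s = 0"
        using least[of 0] least[of "2 *\<^sub>R s"] True sS
        by (intro dual_le_antisym) (auto simp: dual_le_def blinfun.bilinear_simps)
      then show ?thesis using subspace_0[OF \<open>subspace ?V\<close>] by simp
    next
      case False
      then obtain x where x: "x \<in> S" by blast
      with S have xV: "x \<in> \<S>" "disjoint_in \<S> (\<preceq>) B x" by auto
      \<comment> \<open>The negative part of s is handled by a single x in S: as x is below s, it is
        at most the modulus of x.\<close>
      have "pos_part s \<preceq> s + dual_abs x"
      proof (rule ps(4))
        show "0 \<preceq> s + dual_abs x"
          using dual_abs_ge(2)[OF xV(1)] ub[OF x]
          by (force simp: dual_le_def blinfun.bilinear_simps)
        show "s \<preceq> s + dual_abs x"
          using dual_abs_ge(3)[OF xV(1)] by (auto simp: dual_le_def blinfun.bilinear_simps)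
      qed (use sS xV in simp)
      then have "pos_part s - s \<preceq> dual_abs x"
        by (auto simp: dual_le_def blinfun.bilinear_simps algebra_simps)
      then have neg: "v = 0" if "v \<in> \<S>" "0 \<preceq> v" "v \<preceq> B" "v \<preceq> pos_part s - s" for v
        using disjoint_inD[OF xV(2) B xV(1)] that dual_le_trans by blast
      have "0 \<preceq> pos_part s - s"
        using ps(3) by (auto simp: dual_le_def blinfun.bilinear_simps)
      moreover have "dual_abs s = pos_part s + (pos_part s - s)"
        by (simp add: dual_abs_def scaleR_2)
      ultimately have "w = 0" if "w \<in> \<S>" "0 \<preceq> w" "w \<preceq> B" "w \<preceq> dual_abs s" for w
        using that sS ps pos neg by (intro below_sum[of w "pos_part s" "pos_part s - s"]) auto
      then show ?thesis using sS by (simp add: iff)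
    qed
  qed
  moreover have "\<phi> \<in> ?V"
    if "\<phi> \<in> \<S>" "\<psi> \<in> ?V" "modulus_in \<S> (\<preceq>) \<phi> a" "modulus_in \<S> (\<preceq>) \<psi> b" "a \<preceq> b" for \<phi> \<psi> a b
    using that solid[of \<phi> \<psi>] by (auto simp: modulus_in_iff)
  ultimately show ?thesis
    unfolding is_band_def by blast
qed

subsection \<open>Restricting functionals to sets of indices\<close>

definition cut :: "nat set \<Rightarrow> linfty \<Rightarrow> linfty"
  where "cut A x = Bcontfun (\<lambda>n. if n \<in> A then apply_bcontfun x n else 0)"

abbreviation ind :: "nat set \<Rightarrow> linfty"
  where "ind A \<equiv> cut A unit_seq"

lemma apply_cut [simp]:
  "apply_bcontfun (cut A x) n = (if n \<in> A then apply_bcontfun x n else 0)"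
  unfolding cut_def
  by (subst apply_Bcontfun_nat[where K = "norm x"]) (auto simp: linfty_abs_le)

lemma cut_simps [simp]:
  "cut A (x + y) = cut A x + cut A y"
  "cut A (c *\<^sub>R x) = c *\<^sub>R cut A x"
  "cut A (cut B x) = cut (A \<inter> B) x"
  "left_shift (cut A x) = cut (Suc -` A) (left_shift x)"
  by (auto intro!: bcontfun_eqI)

lemma cut_Compl: "cut (- A) x = x - cut A x"
  by (auto intro!: bcontfun_eqI)

lemma linfty_nonneg_cut:
  "linfty_nonneg x \<Longrightarrow> linfty_nonneg (cut A x)"
  by (auto simp: linfty_nonneg_def)

lemma norm_cut_le: "norm (cut A x) \<le> norm x"
  by (intro norm_bound) (auto simp: linfty_abs_le)

definition restr :: "nat set \<Rightarrow> linfty_dual \<Rightarrow> linfty_dual"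
  where "restr A \<phi> = Blinfun (\<lambda>x. \<phi> (cut A x))"

lemma apply_restr [simp]: "restr A \<phi> x = \<phi> (cut A x)"
proof -
  have "bounded_linear (cut A)"
    by (intro bounded_linear_intro[where K = 1]) (auto simp: norm_cut_le)
  then have "bounded_linear (\<lambda>x. \<phi> (cut A x))"
    by (rule bounded_linear_compose[OF blinfun.bounded_linear_right])
  then show ?thesis
    by (simp add: restr_def bounded_linear_Blinfun_apply)
qed

lemma dual_le_mono:
  assumes "0 \<preceq> \<phi>" "\<And>n. apply_bcontfun x n \<le> apply_bcontfun y n"
  shows "\<phi> x \<le> \<phi> y"
proof -
  have "0 \<le> \<phi> (y - x)"
    using assms by (auto simp: dual_le_def linfty_nonneg_def)
  then show ?thesis by (simp add: blinfun.bilinear_simps)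
qed

lemma restr_nonneg: "0 \<preceq> \<phi> \<Longrightarrow> 0 \<preceq> restr A \<phi>"
  by (simp add: dual_le_def linfty_nonneg_cut)

lemma restr_le: "0 \<preceq> \<phi> \<Longrightarrow> restr A \<phi> \<preceq> \<phi>"
  by (auto simp: dual_le_def[of "restr A \<phi>"] linfty_nonneg_def intro!: dual_le_mono)

lemma shift_invariant_iterate:
  "\<phi> \<in> \<S> \<Longrightarrow> \<phi> ((left_shift ^^ k) x) = \<phi> x" for \<phi> :: linfty_dual
  by (induction k) (auto simp: shift_invariantD)

lemma apply_iterate_left_shift [simp]:
  "apply_bcontfun ((left_shift ^^ k) x) n = apply_bcontfun x (n + k)"
  by (induction k arbitrary: n) auto

lemma apply_sum_bcontfun: "apply_bcontfun (sum f I) n = (\<Sum>i\<in>I. apply_bcontfun (f i) n)"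
  for f :: "_ \<Rightarrow> linfty"
  by (induction I rule: infinite_finite_induct) auto

text \<open>Far out, a window of \<open>L\<close> consecutive indices contains at most one square.\<close>

lemma shift_invariant_squares:
  fixes \<phi> :: linfty_dual
  assumes \<phi>: "\<phi> \<in> \<S>" "0 \<preceq> \<phi>"
  shows "\<phi> (ind (range (\<lambda>m. m\<^sup>2))) = 0" (is "\<phi> ?s = 0")
proof -
  have "real L * \<phi> ?s \<le> \<phi> unit_seq" for L
  proof -
    \<comment> \<open>The offset \<open>L\<^sup>2\<close> ensures that a square
      \<open>c\<^sup>2\<close> met by the window has c at least L, so the next square is more than L
      further on.\<close>
    have "real L * \<phi> ?s = \<phi> (\<Sum>j<L. (left_shift ^^ (L\<^sup>2 + j)) ?s)"
      by (simp add: blinfun.bilinear_simps shift_invariant_iterate[OF \<phi>(1)])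
    also have "\<dots> \<le> \<phi> unit_seq"
    proof (rule dual_le_mono[OF \<phi>(2)])
      fix n
      let ?W = "{j\<in>{..<L}. n + (L\<^sup>2 + j) \<in> range (\<lambda>m. m\<^sup>2)}"
      have "\<not> i < j" if ij: "i \<in> ?W" "j \<in> ?W" for i j
      proof
        assume "i < j"
        from ij obtain c d where c: "n + (L\<^sup>2 + i) = c\<^sup>2" and d: "n + (L\<^sup>2 + j) = d\<^sup>2"
          by auto
        have "L\<^sup>2 \<le> c\<^sup>2" using c by linarith
        then have "L \<le> c" by (simp add: power2_nat_le_eq_le)
        have "c\<^sup>2 < d\<^sup>2" using c d \<open>i < j\<close> by linarith
        then have "Suc c \<le> d" by (simp add: Suc_le_eq power_less_imp_less_base)
        then have "(Suc c)\<^sup>2 \<le> d\<^sup>2" by (rule power_mono) simp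
        then have "c\<^sup>2 + 2 * c + 1 \<le> d\<^sup>2" by (simp add: power2_eq_square)
        with c d \<open>L \<le> c\<close> ij show False by auto
      qed
      then have "card ?W \<le> Suc 0"
        by (subst card_le_Suc0_iff_eq) (auto simp: not_less intro!: antisym)
      moreover have "apply_bcontfun (\<Sum>j<L. (left_shift ^^ (L\<^sup>2 + j)) ?s) n = real (card ?W)"
        by (simp add: apply_sum_bcontfun sum.If_cases Int_def)
      ultimately show "apply_bcontfun (\<Sum>j<L. (left_shift ^^ (L\<^sup>2 + j)) ?s) n
          \<le> apply_bcontfun unit_seq n"
        by simp
    qed
    finally show ?thesis .
  qed
  then have "\<phi> ?s \<le> 0"
    by (meson not_le reals_Archimedean3)
  moreover have "0 \<le> \<phi> ?s"
    using \<phi>(2) by (simp add: dual_le_def linfty_nonneg_cut)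
  ultimately show ?thesis by simp
qed

lemma floor_sqrt_Suc_eq:
  assumes "Suc n \<notin> range (\<lambda>m. m\<^sup>2)"
  shows "floor_sqrt (Suc n) = floor_sqrt n"
proof (rule floor_sqrt_unique)
  show "(floor_sqrt n)\<^sup>2 \<le> Suc n"
    using floor_sqrt_power2_le[of n] by linarith
  show "Suc n < (Suc (floor_sqrt n))\<^sup>2"
    using Suc_floor_sqrt_power2_gt[of n] assms by (metis Suc_lessI rangeI)
qed

text \<open>\<open>floor_sqrt n\<close> is the number of the block of n. Cutting and shifting
  commute except where n + 1 is a square, so the defect y is dominated by a multiple of the shifted
  indicator of the squares, on which \<phi> vanishes.\<close>

lemma restr_shift_invariant:
  assumes \<phi>: "\<phi> \<in> \<S>" "0 \<preceq> \<phi>"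
  shows "restr (floor_sqrt -` S) \<phi> \<in> \<S>"
proof (rule shift_invariant_functionalsI)
  fix x
  let ?A = "floor_sqrt -` S"
  let ?s = "left_shift (ind (range (\<lambda>m. m\<^sup>2)))"
  have s: "\<phi> ?s = 0"
    using \<phi> by (simp only: shift_invariantD shift_invariant_squares)
  define y where "y = cut ?A (left_shift x) - left_shift (cut ?A x)"
  have y: "\<bar>apply_bcontfun y n\<bar> \<le> norm x * apply_bcontfun ?s n" for n
    using linfty_abs_le[of x "Suc n"] floor_sqrt_Suc_eq[of n] by (auto simp: y_def)
  have "\<phi> y \<le> \<phi> (norm x *\<^sub>R ?s)" "\<phi> (- y) \<le> \<phi> (norm x *\<^sub>R ?s)"
    using y by (auto intro!: dual_le_mono[OF \<phi>(2)] simp: abs_le_iff simp del: cut_simps apply_left_shift)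
  then have "\<phi> y = 0"
    using s by (simp add: blinfun.bilinear_simps del: cut_simps)
  then show "restr ?A \<phi> (left_shift x) = restr ?A \<phi> x"
    using shift_invariantD[OF \<phi>(1), of "cut ?A x"]
    by (simp add: y_def blinfun.bilinear_simps)
qed

text \<open>The restriction of an atom \<open>a\<close> to a union of blocks lies below \<open>a\<close>, so it is a multiple of
  \<open>a\<close>; as restricting is idempotent, the factor is \<open>0\<close> or \<open>1\<close>.\<close>

lemma atom_zero_one:
  assumes "a \<in> atoms_of \<S> (\<preceq>)"
  shows "a (ind (floor_sqrt -` S)) = 0 \<or> a (ind (- (floor_sqrt -` S))) = 0"
proof -
  let ?A = "floor_sqrt -` S"
  have "restr ?A a \<in> \<S>" "0 \<preceq> restr ?A a" "restr ?A a \<preceq> a"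
    using assms by (auto simp: atoms_of_def restr_shift_invariant restr_nonneg restr_le)
  then obtain c where "restr ?A a = c *\<^sub>R a"
    using assms unfolding atoms_of_def by blast
  then have "restr ?A a x = c * a x" for x
    by (simp add: blinfun.bilinear_simps)
  \<comment> \<open>Either \<open>a (ind ?A)\<close> is 0, or the second instance gives c = 1 and
    then the first one leaves no mass for the complement.\<close>
  from this[of unit_seq] this[of "ind ?A"]
  show ?thesis
    by (auto simp: cut_Compl blinfun.bilinear_simps)
qed

subsection \<open>A criterion for continuity\<close>

text \<open>The \<open>m\<close>-th block is \<open>{m\<^sup>2..<(m + 1)\<^sup>2}\<close>; the blocks are put into \<open>M\<close> classes according to
  their number modulo \<open>M\<close>.\<close>

definition block_class :: "nat \<Rightarrow> nat \<Rightarrow> nat set"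
  where "block_class M k = floor_sqrt -` {m. m mod M = k}"

lemma sum_cut_block_class:
  assumes "0 < M"
  shows "(\<Sum>k<M. cut (block_class M k) x) = x"
proof (rule bcontfun_eqI)
  fix n
  have "{..<M} \<inter> {k. floor_sqrt n mod M = k} = {floor_sqrt n mod M}"
    using assms by auto
  with mod_less_divisor[OF assms, of "floor_sqrt n"]
  show "apply_bcontfun (\<Sum>k<M. cut (block_class M k) x) n = apply_bcontfun x n"
    by (simp add: apply_sum_bcontfun block_class_def sum.If_cases)
qed

text \<open>By the zero-one law a nonzero atom a lives on one class modulo M. A functional w below
  both has mass at most \<epsilon> on that class because of B, and none off it because of a.\<close>

lemma disjoint_from_atom:
  assumes B: "B \<in> \<S>" "0 \<preceq> B"
    and small: "\<And>\<epsilon>. 0 < \<epsilon> \<Longrightarrow> \<exists>M>0. \<forall>k<M. B (ind (block_class M k)) \<le> \<epsilon>"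
    and a: "a \<in> atoms_of \<S> (\<preceq>)"
  shows "disjoint_in \<S> (\<preceq>) B a"
proof -
  have aS: "a \<in> \<S>" "0 \<preceq> a" "a \<noteq> 0" using a by (auto simp: atoms_of_def)
  have "w = 0" if w: "w \<in> \<S>" "0 \<preceq> w" "w \<preceq> B" "w \<preceq> a" for w
  proof (rule dual_nonneg_eq_zero[OF w(2)], rule field_le_epsilon)
    fix \<epsilon> :: real assume "0 < \<epsilon>"
    then obtain M where M: "0 < M" "\<And>k. k < M \<Longrightarrow> B (ind (block_class M k)) \<le> \<epsilon>"
      using small by blast
    have "\<exists>k<M. a (ind (block_class M k)) \<noteq> 0"
    proof (rule ccontr)
      assume "\<not> ?thesis"
      then have "(\<Sum>k<M. a (ind (block_class M k))) = 0" by simp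
      then have "a unit_seq = 0"
        using sum_cut_block_class[OF M(1), of unit_seq] by (simp flip: blinfun.sum_right)
      then show False using dual_nonneg_eq_zero[OF aS(2)] aS(3) by simp
    qed
    then obtain k where k: "k < M" "a (ind (- block_class M k)) = 0"
      using atom_zero_one[OF a] unfolding block_class_def by blast
    have "w (ind (block_class M k)) \<le> B (ind (block_class M k))"
      using w(3) by (simp add: dual_le_def linfty_nonneg_cut)
    moreover have "w (ind (- block_class M k)) \<le> a (ind (- block_class M k))"
      using w(4) by (simp add: dual_le_def linfty_nonneg_cut)
    ultimately have "w (ind (block_class M k)) + w (ind (- block_class M k)) \<le> \<epsilon>"
      using M(2)[OF k(1)] k(2) by linarith
    then show "w unit_seq \<le> 0 + \<epsilon>"
      by (simp add: cut_Compl blinfun.bilinear_simps)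
  qed
  then show ?thesis
    using aS by (simp add: disjoint_in_iff[OF B] dual_abs_nonneg)
qed

text \<open>The functionals disjoint from B form a band; once it contains the atoms, it contains the
  band they generate.\<close>

lemma continuous_banach_limitI:
  assumes B: "B \<in> banach_limits"
    and small: "\<And>\<epsilon>. 0 < \<epsilon> \<Longrightarrow> \<exists>M>0. \<forall>k<M. B (ind (block_class M k)) \<le> \<epsilon>"
  shows "B \<in> continuous_banach_limits"
proof -
  have BS: "B \<in> \<S>" "0 \<preceq> B"
    using B by (auto simp: banach_limits_def shift_invariant_functionals_def)
  have "atoms_of \<S> (\<preceq>) \<subseteq> {\<phi>\<in>\<S>. disjoint_in \<S> (\<preceq>) B \<phi>}"
    using disjoint_from_atom[OF BS small] by (auto simp: atoms_of_def)
  then have "band_generated \<S> (\<preceq>) (atoms_of \<S> (\<preceq>)) \<subseteq> {\<phi>\<in>\<S>. disjoint_in \<S> (\<preceq>) B \<phi>}"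
    unfolding band_generated_def using is_band_disjoint[OF BS] by blast
  then show ?thesis
    using B BS by (auto simp: continuous_banach_limits_def disjoint_complement_def)
qed

subsection \<open>A Banach limit that is equidistributed on the block classes\<close>

text \<open>Banach-Alaoglu by way of Tychonoff: the functionals lie in a compact product of
  intervals, so they have a pointwise cluster point. Linearity is a closed condition and passes to
  it. Lower bounds follow by applying the conclusion to -x.\<close>

lemma ex_cluster_functional:
  fixes e :: "nat \<Rightarrow> 'a::real_normed_vector \<Rightarrow>\<^sub>L real"
  assumes "\<And>n. norm (e n) \<le> K"
  obtains l :: "'a \<Rightarrow>\<^sub>L real" where "\<And>x c. \<forall>\<^sub>F n in sequentially. e n x \<le> c \<Longrightarrow> l x \<le> c"
proof -
  have e: "\<bar>e n x\<bar> \<le> norm x * K" for n x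
    using order_trans[OF norm_blinfun[of "e n" x] mult_right_mono[OF assms[of n] norm_ge_zero[of x]]]
    by (simp add: mult.commute)
  define U where "U = PiE UNIV (\<lambda>x::'a. {-(norm x * K)..norm x * K})"
  have "compactin (product_topology (\<lambda>_. euclidean) UNIV) U"
    unfolding U_def by (subst compactin_PiE) (simp add: compactin_euclidean_iff)
  then have "compact U"
    by (simp add: euclidean_product_topology compactin_euclidean_iff)
  let ?F = "filtermap (\<lambda>n. blinfun_apply (e n)) sequentially"
  have "\<forall>\<^sub>F f in ?F. f \<in> U"
    using e by (simp add: eventually_filtermap U_def PiE_iff abs_le_iff minus_le_iff)
  moreover have "?F \<noteq> bot" by (simp add: filtermap_bot_iff)
  ultimately obtain g where g: "g \<in> U" "inf (nhds g) ?F \<noteq> bot"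
    using \<open>compact U\<close> unfolding compact_filter by blast
  \<comment> \<open>A cluster point lies in every closed set that eventually contains the
    sequence.\<close>
  have closedD: "g \<in> C" if "closed C" "\<forall>\<^sub>F n in sequentially. blinfun_apply (e n) \<in> C" for C
  proof (rule ccontr)
    assume "g \<notin> C"
    then have "\<forall>\<^sub>F f in nhds g. f \<in> - C"
      using that(1) by (intro eventually_nhds_in_open) auto
    moreover have "\<forall>\<^sub>F f in ?F. f \<in> C" using that(2) by (simp add: eventually_filtermap)
    ultimately have "\<forall>\<^sub>F f in inf (nhds g) ?F. False"
      unfolding eventually_inf by blast
    with g(2) show False by (simp add: trivial_limit_def)
  qed
  note coordinate = continuous_on_product_coordinates
  have "closed {f :: 'a \<Rightarrow> real. f (x + y) = f x + f y}" for x y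
    by (intro closed_Collect_eq continuous_on_add coordinate)
  from closedD[OF this] have "g (x + y) = g x + g y" for x y
    by (simp add: blinfun.add_right)
  moreover have "closed {f :: 'a \<Rightarrow> real. f (c *\<^sub>R x) = c * f x}" for c x
    by (intro closed_Collect_eq continuous_on_mult continuous_on_const coordinate)
  from closedD[OF this] have "g (c *\<^sub>R x) = c * g x" for c x
    by (simp add: blinfun.scaleR_right)
  moreover have "norm (g x) \<le> norm x * K" for x
    using g(1) by (auto simp: U_def PiE_iff abs_le_iff minus_le_iff)
  ultimately have "bounded_linear g"
    by (intro bounded_linear_intro) auto
  moreover have "g x \<le> c" if "\<forall>\<^sub>F n in sequentially. e n x \<le> c" for x c
  proof -
    have "closed {f :: 'a \<Rightarrow> real. f x \<le> c}"
      by (intro closed_Collect_le continuous_on_const coordinate)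
    from closedD[OF this] that show ?thesis by simp
  qed
  ultimately show thesis
    using that[of "Blinfun g"] by (simp add: bounded_linear_Blinfun_apply)
qed

text \<open>The average over the first n + 1 entries of the blocks numbered n to 2n. Averaging
  within blocks gives asymptotic shift invariance, averaging over blocks gives
  equidistribution.\<close>

definition block_mean :: "nat \<Rightarrow> linfty \<Rightarrow> real"
  where "block_mean n x = (\<Sum>i\<le>n. \<Sum>j\<le>n. apply_bcontfun x ((n + i)\<^sup>2 + j)) / (real (Suc n))\<^sup>2"

lemma block_mean_simps [simp]:
  "block_mean n (x + y) = block_mean n x + block_mean n y"
  "block_mean n (x - y) = block_mean n x - block_mean n y"
  "block_mean n (- x) = - block_mean n x"
  "block_mean n (c *\<^sub>R x) = c * block_mean n x"
  "block_mean n unit_seq = 1"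
  by (auto simp: block_mean_def sum.distrib sum_subtractf sum_negf add_divide_distrib diff_divide_distrib
      sum_distrib_left const_bcontfun.rep_eq power2_eq_square)

lemma block_mean_nonneg: "linfty_nonneg x \<Longrightarrow> 0 \<le> block_mean n x"
  by (auto simp: block_mean_def linfty_nonneg_def intro!: sum_nonneg divide_nonneg_nonneg)

text \<open>Each of the n + 1 inner sums telescopes to two boundary terms, while the divisor is
  quadratic in n + 1.\<close>

lemma block_mean_left_shift:
  "\<bar>block_mean n (left_shift x) - block_mean n x\<bar> \<le> 2 * norm x / real (Suc n)"
proof -
  have "\<bar>\<Sum>j\<le>n. apply_bcontfun (left_shift x) (m + j) - apply_bcontfun x (m + j)\<bar> \<le> 2 * norm x"
    for m
    using linfty_abs_le[of x m] linfty_abs_le[of x "m + Suc n"]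
      sum_telescope[of "\<lambda>j. - apply_bcontfun x (m + j)" n]
    by simp
  then have "\<bar>\<Sum>i\<le>n. \<Sum>j\<le>n. apply_bcontfun (left_shift x) ((n + i)\<^sup>2 + j)
      - apply_bcontfun x ((n + i)\<^sup>2 + j)\<bar> \<le> (\<Sum>i\<le>n. 2 * norm x)" (is "\<bar>?D\<bar> \<le> _")
    by (intro order_trans[OF sum_abs[of _ "{..n}"] sum_mono])
  moreover have "block_mean n (left_shift x) - block_mean n x = ?D / (real (Suc n))\<^sup>2"
    by (simp add: block_mean_def sum_subtractf diff_divide_distrib del: apply_left_shift)
  ultimately have "\<bar>block_mean n (left_shift x) - block_mean n x\<bar>
      \<le> real (Suc n) * (2 * norm x) / (real (Suc n))\<^sup>2"
    by (simp add: abs_divide divide_right_mono del: of_nat_Suc)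
  then show ?thesis
    by (simp add: power2_eq_square del: of_nat_Suc)
qed

lemma block_mean_ind_floor_sqrt:
  "block_mean n (ind (floor_sqrt -` S)) = (\<Sum>i\<le>n. of_bool (n + i \<in> S)) / real (Suc n)"
proof -
  \<comment> \<open>The block numbered m has 2m + 1 entries, so for m at least n its first n + 1
    indices stay inside it.\<close>
  have "floor_sqrt ((n + i)\<^sup>2 + j) = n + i" if "j \<le> n" for i j
    by (rule floor_sqrt_unique) (use that in \<open>auto simp: power2_eq_square\<close>)
  then have "(\<Sum>j\<le>n. apply_bcontfun (ind (floor_sqrt -` S)) ((n + i)\<^sup>2 + j))
      = real (Suc n) * of_bool (n + i \<in> S)" for i
    by (subst sum.cong[OF refl, where h = "\<lambda>_. of_bool (n + i \<in> S)"]) auto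
  then show ?thesis
    by (simp add: block_mean_def power2_eq_square flip: sum_distrib_left del: of_nat_Suc)
qed

text \<open>Here the sum over block numbers telescopes. In the limit, neighbouring residue classes
  of blocks therefore receive equal mass.\<close>

lemma block_mean_ind_shift:
  "\<bar>block_mean n (ind (floor_sqrt -` (Suc -` S))) - block_mean n (ind (floor_sqrt -` S))\<bar>
    \<le> 1 / real (Suc n)"
proof -
  have "\<bar>\<Sum>i\<le>n. of_bool (Suc (n + i) \<in> S) - of_bool (n + i \<in> S) :: real\<bar> \<le> 1"
    using sum_telescope[of "\<lambda>i. - of_bool (n + i \<in> S) :: real" n] by simp
  then show ?thesis
    by (simp add: block_mean_ind_floor_sqrt sum_subtractf divide_right_mono abs_divide
        flip: diff_divide_distrib del: of_nat_Suc)
qed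

lemma ex_equidistributed_banach_limit:
  obtains B where "B \<in> banach_limits" "\<And>M k. k < M \<Longrightarrow> B (ind (block_class M k)) = 1 / real M"
proof -
  have "bounded_linear (block_mean n)" for n
    by (rule positive_linear_imp_bounded_linear) (auto intro!: linearI block_mean_nonneg)
  then have "\<forall>n. \<exists>e :: linfty_dual. \<forall>x. e x = block_mean n x"
    by (metis bounded_linear_Blinfun_apply)
  then obtain e :: "nat \<Rightarrow> linfty_dual" where e: "\<And>n x. e n x = block_mean n x"
    by metis
  have "norm (e n) \<le> 1" for n
    using dual_nonneg_abs_le[of "e n"]
    by (intro norm_blinfun_bound) (auto simp: dual_le_def e block_mean_nonneg)
  then obtain B :: linfty_dual where B: "\<And>x c. \<forall>\<^sub>F n in sequentially. e n x \<le> c \<Longrightarrow> B x \<le> c"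
    by (rule ex_cluster_functional[of e 1]) (rule that)
  have vanish: "B x = 0" if bound: "\<And>n. \<bar>block_mean n x\<bar> \<le> c / real (Suc n)" for x c
  proof -
    have lim: "(\<lambda>n. c / real (Suc n)) \<longlonglongrightarrow> 0"
      using LIMSEQ_inverse_real_of_nat tendsto_mult_right_zero by (auto simp: divide_inverse)
    have "B x \<le> \<epsilon>" "B (- x) \<le> \<epsilon>" if "0 < \<epsilon>" for \<epsilon>
    proof -
      have "\<forall>\<^sub>F n in sequentially. \<bar>block_mean n x\<bar> \<le> \<epsilon>"
        using order_tendstoD(2)[OF lim that]
        by (rule eventually_mono) (meson bound less_imp_le order_trans)
      then show "B x \<le> \<epsilon>" "B (- x) \<le> \<epsilon>"
        by (auto intro!: B simp: e abs_le_iff elim!: eventually_mono)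
    qed
    then have "B x \<le> 0" "B (- x) \<le> 0"
      by (auto intro: field_le_epsilon)
    then show ?thesis by (simp add: blinfun.minus_right)
  qed
  have B1: "B unit_seq = 1"
    using B[of unit_seq 1] B[of "- unit_seq" "- 1"] by (simp add: e blinfun.minus_right)
  have "0 \<le> B x" if "linfty_nonneg x" for x
    using B[of "- x" 0] block_mean_nonneg[OF that] by (simp add: e blinfun.minus_right)
  then have B0: "0 \<preceq> B" by (simp add: dual_le_def)
  have "B (left_shift x - x) = 0" for x
    by (rule vanish[of _ "2 * norm x"]) (use block_mean_left_shift in simp)
  then have "B (left_shift x) = B x" for x
    by (simp add: blinfun.diff_right)
  with B0 B1 have "B \<in> banach_limits"
    by (simp add: banach_limits_def)
  moreover have "B (ind (block_class M k)) = 1 / real M" if "k < M" for M k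
  proof -
    \<comment> \<open>Since k + 1 is a nonzero residue, its preimage under \<open>Suc\<close> is
      exactly the class of k. Hence all M masses agree, and they add up to 1.\<close>
    have step: "B (ind (block_class M k)) = B (ind (block_class M (Suc k)))" if "Suc k < M" for k
    proof -
      have "Suc -` {m. m mod M = Suc k} = {m. m mod M = k}"
        using that by (auto simp: mod_Suc)
      then have "B (ind (block_class M k) - ind (block_class M (Suc k))) = 0"
        using block_mean_ind_shift[of _ "{m. m mod M = Suc k}"]
        by (intro vanish[of _ 1]) (simp add: block_class_def)
      then show ?thesis by (simp add: blinfun.diff_right)
    qed
    have const: "B (ind (block_class M k)) = B (ind (block_class M 0))" if "k < M" for k
      using that by (induction k) (use step in force)+
    have "(\<Sum>k<M. B (ind (block_class M k))) = 1"
      using sum_cut_block_class[of M unit_seq] that B1 by (simp flip: blinfun.sum_right)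
    moreover have "(\<Sum>k<M. B (ind (block_class M k))) = (\<Sum>k<M. B (ind (block_class M 0)))"
      by (intro sum.cong refl const) simp
    ultimately have "real M * B (ind (block_class M 0)) = 1"
      by simp
    then show ?thesis using const[OF that] that by (simp add: field_simps)
  qed
  ultimately show thesis by (rule that)
qed

subsection \<open>The radius\<close>

text \<open>The equidistributed limit is restricted to the class and multiplied by N. This costs
  only a factor N: the masses modulo M are at most N/M, which is small for large M.\<close>

lemma ex_concentrated_continuous_banach_limit:
  assumes "i < N"
  obtains C where "C \<in> continuous_banach_limits" "C (ind (block_class N i)) = 1"
proof -
  obtain B where B: "B \<in> banach_limits"
    and eq: "\<And>M k. k < M \<Longrightarrow> B (ind (block_class M k)) = 1 / real M"
    by (rule ex_equidistributed_banach_limit) (rule that)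
  have BS: "B \<in> \<S>" "0 \<preceq> B"
    using B by (auto simp: banach_limits_def shift_invariant_functionals_def)
  let ?A = "block_class N i"
  define C where "C = real N *\<^sub>R restr ?A B"
  have C: "C x = real N * B (cut ?A x)" for x
    by (simp add: C_def blinfun.scaleR_left)
  have "restr ?A B \<in> \<S>"
    unfolding block_class_def by (rule restr_shift_invariant[OF BS])
  then have "C \<in> \<S>"
    by (simp add: C_def)
  moreover have "0 \<preceq> C"
    using restr_nonneg[OF BS(2)] by (auto simp: dual_le_def C)
  ultimately have "C \<in> banach_limits"
    using eq[OF assms] assms by (simp add: banach_limits_def shift_invariant_functionals_def C)
  moreover have "\<exists>M>0. \<forall>k<M. C (ind (block_class M k)) \<le> \<epsilon>" if "0 < \<epsilon>" for \<epsilon> :: real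
  proof -
    obtain M where "real N < real M * \<epsilon>"
      using reals_Archimedean3[OF \<open>0 < \<epsilon>\<close>] by blast
    moreover from this have "0 < M"
      by (intro Nat.gr0I) auto
    ultimately have M: "0 < M" "real N / real M \<le> \<epsilon>"
      by (auto simp: divide_le_eq mult.commute)
    have "C (ind (block_class M k)) \<le> \<epsilon>" if "k < M" for k
    proof -
      have "B (cut ?A (ind (block_class M k))) \<le> B (ind (block_class M k))"
        by (rule dual_le_mono[OF BS(2)]) auto
      then have "C (ind (block_class M k)) \<le> real N * (1 / real M)"
        unfolding C using eq[OF that] by (intro mult_left_mono) auto
      with M(2) show ?thesis by simp
    qed
    with M(1) show ?thesis by blast
  qed
  ultimately have "C \<in> continuous_banach_limits"
    by (rule continuous_banach_limitI)
  moreover have "C (ind ?A) = 1"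
    using eq[OF assms] assms by (simp add: C)
  ultimately show thesis by (rule that)
qed

lemma norm_banach_limit_le:
  assumes "B \<in> banach_limits"
  shows "norm B \<le> 1"
  using assms dual_nonneg_abs_le[of B]
  by (intro norm_blinfun_bound) (auto simp: banach_limits_def)

text \<open>Given \<open>B\<close>, one of the \<open>N\<close> classes has \<open>B\<close>-mass at most \<open>1/N\<close>, and a continuous Banach limit
  concentrated on that class is almost disjoint from \<open>B\<close>.\<close>

lemma ex_distant_continuous_banach_limit:
  assumes B: "B \<in> banach_limits" and N: "0 < N"
  obtains C where "C \<in> continuous_banach_limits" "2 - 2 / real N \<le> norm (B - C)"
proof -
  have "\<exists>i<N. B (ind (block_class N i)) \<le> 1 / real N"
  proof (rule ccontr)
    assume "\<not> ?thesis"
    then have "(\<Sum>i<N. 1 / real N) < (\<Sum>i<N. B (ind (block_class N i)))"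
      using N by (intro sum_strict_mono) (auto simp: not_le)
    also have "\<dots> = 1"
      using sum_cut_block_class[OF N, of unit_seq] B
      by (simp add: banach_limits_def flip: blinfun.sum_right)
    finally show False using N by simp
  qed
  then obtain i where i: "i < N" "B (ind (block_class N i)) \<le> 1 / real N" by blast
  obtain C where C: "C \<in> continuous_banach_limits" "C (ind (block_class N i)) = 1"
    by (rule ex_concentrated_continuous_banach_limit[OF i(1)]) (rule that)
  then have C1: "C unit_seq = 1"
    by (simp add: continuous_banach_limits_def banach_limits_def)
  \<comment> \<open>This sequence is -1 on the class and 1 off it: C takes the value -1 there, and B
    at least 1 - 2/N.\<close>
  let ?x = "unit_seq - 2 *\<^sub>R ind (block_class N i)"
  have "norm ?x \<le> 1"
    by (intro norm_bound) auto
  have "2 - 2 / real N \<le> (B - C) ?x"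
    using i(2) B C(2) C1 by (simp add: blinfun.bilinear_simps banach_limits_def)
  also have "\<dots> \<le> norm (B - C) * norm ?x"
    using norm_blinfun[of "B - C" ?x] by simp
  also have "\<dots> \<le> norm (B - C)"
    using \<open>norm ?x \<le> 1\<close> by (simp add: mult_left_le)
  finally show thesis using C(1) that by blast
qed

theorem theorem3p7:
  shows "radius continuous_banach_limits = 2"
proof -
  \<comment> \<open>Every centre B gives the same supremum, so the infimum is over a
    constant.\<close>
  have "(SUP C\<in>continuous_banach_limits. ereal (norm (B - C))) = 2"
    if "B \<in> continuous_banach_limits" for B
  proof (rule antisym)
    have B: "B \<in> banach_limits" using that by (simp add: continuous_banach_limits_def)
    show "(SUP C\<in>continuous_banach_limits. ereal (norm (B - C))) \<le> 2"
    proof (rule SUP_least)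
      fix C assume "C \<in> continuous_banach_limits"
      then have "norm B + norm C \<le> 2"
        using norm_banach_limit_le[of B] norm_banach_limit_le[of C] B
        by (auto simp: continuous_banach_limits_def)
      then show "ereal (norm (B - C)) \<le> 2"
        using norm_triangle_ineq4[of B C] by simp
    qed
    have "ereal (2 - 2 / real (Suc n)) \<le> (SUP C\<in>continuous_banach_limits. ereal (norm (B - C)))" for n
      by (rule ex_distant_continuous_banach_limit[OF B zero_less_Suc[of n]]) (auto intro: SUP_upper2)
    moreover have "(\<lambda>n. ereal (2 - 2 / real (Suc n))) \<longlonglongrightarrow> ereal 2"
    proof -
      have "(\<lambda>n. 2 - 2 * inverse (real (Suc n))) \<longlonglongrightarrow> 2 - 2 * 0"
        by (intro tendsto_intros LIMSEQ_inverse_real_of_nat)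
      then show ?thesis by (simp add: divide_inverse)
    qed
    ultimately show "2 \<le> (SUP C\<in>continuous_banach_limits. ereal (norm (B - C)))"
      by (intro LIMSEQ_le_const2[where X = "\<lambda>n. ereal (2 - 2 / real (Suc n))"]) auto
  qed
  then have "radius continuous_banach_limits = (INF B\<in>continuous_banach_limits. 2)"
    unfolding radius_def by (intro INF_cong refl)
  \<comment> \<open>Over the empty set the infimum would be infinite.\<close>
  moreover have "continuous_banach_limits \<noteq> {}"
    by (rule ex_concentrated_continuous_banach_limit[OF zero_less_one]) blast
  ultimately show ?thesis
    by simp
qed

end
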